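(* Let $\alpha,\beta>0$ with $\alpha+\beta<\pi$, let $\mathcal T$ be the closed triangle with base from $(0,0)$ to $(1,0)$ and base angles $\alpha$ at $(0,0)$ and $\beta$ at $(1,0)$, third vertex in the upper half-plane. Let $\boldsymbol\gamma:[0,1]\to\mathbb R^2$ be a continuous path with $\boldsymbol\gamma(0)=\mathbf 0$. Then $\boldsymbol\gamma$ escapes $\mathcal T$ for every starting position $\mathbf s\in\mathcal T$ and every orientation $\theta\in[0,2\pi)$ if and only if $$F_{\boldsymbol\gamma}(t)\ \ge\ \sin\alpha\,\sin\beta\qquad\text{for all } t\in[0,2\pi).$$
   Context: The triangle is $\mathcal T=\{\mathbf x\in\mathbb R^2:\ \mathbf n_j\cdot\mathbf x\le b_j,\ j=1,2,3\}$ with $\mathbf n_1=(-\sin\alpha,\cos\alpha)$, $\mathbf n_2=(\sin\beta,\cos\beta)$, $\mathbf n_3=(0,-1)$, $b_1=0$, $b_2=\sin\beta$, $b_3=0$. Let $R_\theta$ denote counterclockwise rotation of the plane by $\theta$. A path $\boldsymbol\gamma$ starting at the origin escapes $\mathcal T$ for starting position $\mathbf s\in\mathcal T$ and orientation $\theta$ if the moved path $p\mapsto \mathbf s+R_\theta\boldsymbol\gamma(p)$ is not entirely contained in the interior of $\mathcal T$ (equivalently, since it starts in $\mathcal T$ and is continuous, it meets the boundary $\partial\mathcal T$). The support function of the path is $h_{\boldsymbol\gamma}(\phi)=\max_{p\in[0,1]}\boldsymbol\gamma(p)\cdot(\cos\phi,\sin\phi)$, and $$F_{\boldsymbol\gamma}(t)=\sin\beta\,h_{\boldsymbol\gamma}(t+\pi+\alpha)+\sin\alpha\,h_{\boldsymbol\gamma}(t+\pi-\beta)+\sin(\alpha+\beta)\,h_{\boldsymbol\gamma}(t).$$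 *)

theory Defs
  imports "HOL-Analysis.Analysis"
begin

(* The triangle with base from (0,0) to (1,0) and base angles alpha at (0,0), beta at (1,0),
   cut out by the outward unit normals of its left, right and bottom sides. *)
definition base_triangle :: "real \<Rightarrow> real \<Rightarrow> (real ^ 2) set" where
  "base_triangle \<alpha> \<beta> =
     {x. vector [- sin \<alpha>, cos \<alpha>] \<bullet> x \<le> 0 \<and>
         vector [sin \<beta>, cos \<beta>] \<bullet> x \<le> sin \<beta> \<and>
         vector [0, -1] \<bullet> x \<le> 0}"

definition rotate_ccw :: "real \<Rightarrow> real ^ 2 \<Rightarrow> real ^ 2" where
  "rotate_ccw \<theta> x =
     vector [cos \<theta> * x $ 1 - sin \<theta> * x $ 2, sin \<theta> * x $ 1 + cos \<theta> * x $ 2]"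

definition escapes ::
  "(real \<Rightarrow> real ^ 2) \<Rightarrow> (real ^ 2) set \<Rightarrow> real ^ 2 \<Rightarrow> real \<Rightarrow> bool" where
  "escapes \<gamma> T s \<theta> \<longleftrightarrow>
     \<not> path_image (\<lambda>p. s + rotate_ccw \<theta> (\<gamma> p)) \<subseteq> interior T"

(* For a path the supremum is a maximum, since [0,1] is compact. *)
definition support_fun :: "(real \<Rightarrow> real ^ 2) \<Rightarrow> real \<Rightarrow> real" where
  "support_fun \<gamma> \<phi> = (SUP p\<in>{0..1}. \<gamma> p \<bullet> vector [cos \<phi>, sin \<phi>])"

definition escape_fun :: "real \<Rightarrow> real \<Rightarrow> (real \<Rightarrow> real ^ 2) \<Rightarrow> real \<Rightarrow> real" where
  "escape_fun \<alpha> \<beta> \<gamma> t =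
     sin \<beta> * support_fun \<gamma> (t + pi + \<alpha>) +
     sin \<alpha> * support_fun \<gamma> (t + pi - \<beta>) +
     sin (\<alpha> + \<beta>) * support_fun \<gamma> t"

end

theory Submission imports Defs begin

text \<open>
  The moved path lies in the open triangle iff \<open>n\<^sub>j \<bullet> s < b\<^sub>j - H\<^sub>j\<close> for \<open>j = 1, 2, 3\<close>, where
  \<open>H\<^sub>j\<close> is the support function of the path at the angle of \<open>n\<^sub>j\<close> turned back by \<open>\<theta>\<close>. The normals
  satisfy the single linear relation \<open>sin \<beta> n\<^sub>1 + sin \<alpha> n\<^sub>2 + sin (\<alpha> + \<beta>) n\<^sub>3 = 0\<close> with positive
  coefficients, so a suitable \<open>s\<close> exists iff the same combination of the numbers \<open>b\<^sub>j - H\<^sub>j\<close>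
  is positive. With \<open>t = - \<pi>/2 - \<theta>\<close> this combination is \<open>sin \<alpha> sin \<beta> - F(t)\<close>.
\<close>

lemma inner_vector_2: "(vector [a, b] :: real ^ 2) \<bullet> x = a * x $ 1 + b * x $ 2"
  by (simp add: inner_vec_def UNIV_2)

lemma vector_2_eq_0_iff: "(vector [a, b] :: real ^ 2) = 0 \<longleftrightarrow> a = 0 \<and> b = 0"
  by (simp add: vec_eq_iff forall_2)

text \<open>By compactness of the unit interval the supremum is attained. This is what lets a strict
  bound pass from the single points to the supremum.\<close>

lemma support_fun_less_iff:
  assumes "path \<gamma>"
  shows "support_fun \<gamma> \<phi> < c \<longleftrightarrow> (\<forall>p\<in>{0..1}. \<gamma> p \<bullet> vector [cos \<phi>, sin \<phi>] < c)"
proof -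
  define f where "f = (\<lambda>p. \<gamma> p \<bullet> vector [cos \<phi>, sin \<phi>])"
  have cont: "continuous_on {0..1} f"
    using assms unfolding path_def f_def by (intro continuous_intros)
  obtain q where q: "q \<in> {0..1}" "\<And>p. p \<in> {0..1} \<Longrightarrow> f p \<le> f q"
    using continuous_attains_sup[OF _ _ cont] by auto
  have "(SUP p\<in>{0..1}. f p) = f q"
    using q by (intro cSup_eq_maximum) auto
  then have "support_fun \<gamma> \<phi> = f q"
    by (simp only: support_fun_def f_def)
  moreover have "f q < c \<longleftrightarrow> (\<forall>p\<in>{0..1}. f p < c)"
    using q by (blast intro: order_le_less_trans)
  ultimately show ?thesis
    by (simp only: f_def)
qed

lemma support_fun_periodic:
  "support_fun \<gamma> (\<phi> + 2 * pi * of_int k) = support_fun \<gamma> \<phi>"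
proof -
  have "cos (\<phi> + 2 * pi * of_int k) = cos \<phi>" "sin (\<phi> + 2 * pi * of_int k) = sin \<phi>"
    by (simp_all add: cos_add sin_add)
  then show ?thesis
    by (simp add: support_fun_def)
qed

lemma escape_fun_periodic:
  "escape_fun \<alpha> \<beta> \<gamma> (t + 2 * pi * of_int k) = escape_fun \<alpha> \<beta> \<gamma> t"
proof -
  have shift: "support_fun \<gamma> (t + 2 * pi * of_int k + a) = support_fun \<gamma> (t + a)" for a
    using support_fun_periodic[of \<gamma> "t + a" k] by (simp add: algebra_simps)
  show ?thesis
    using shift[of "pi + \<alpha>"] shift[of "pi - \<beta>"] shift[of 0]
    by (simp add: escape_fun_def algebra_simps)
qed

lemma shift_into_period:
  fixes x :: real
  obtains k :: int where "x + 2 * pi * of_int k \<in> {0..<2 * pi}"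
proof
  define m where "m = \<lfloor>x / (2 * pi)\<rfloor>"
  have "of_int m \<le> x / (2 * pi)" "x / (2 * pi) < of_int m + 1"
    unfolding m_def by linarith+
  then show "x + 2 * pi * of_int (- m) \<in> {0..<2 * pi}"
    by (simp add: field_simps)
qed

text \<open>Rotations are orthogonal, so turning the path by \<open>\<theta>\<close> has the same
  effect on inner products as turning the unit normal back by \<open>\<theta>\<close>.\<close>

lemma inner_rotate_ccw:
  "vector [cos \<phi>, sin \<phi>] \<bullet> rotate_ccw \<theta> x = x \<bullet> vector [cos (\<phi> - \<theta>), sin (\<phi> - \<theta>)]"
  unfolding inner_commute[of x] inner_vector_2
  by (simp add: rotate_ccw_def cos_diff sin_diff algebra_simps)

text \<open>Interior commutes with finite intersections, and a closed half-plane with nonzero normal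
  has the open half-plane as its interior.\<close>

lemma interior_base_triangle:
  "interior (base_triangle \<alpha> \<beta>) =
     {x. vector [- sin \<alpha>, cos \<alpha>] \<bullet> x < 0 \<and>
         vector [sin \<beta>, cos \<beta>] \<bullet> x < sin \<beta> \<and>
         vector [0, -1] \<bullet> x < 0}"
proof -
  have nonzero: "(vector [- sin \<alpha>, cos \<alpha>] :: real ^ 2) \<noteq> 0"
      "(vector [sin \<beta>, cos \<beta>] :: real ^ 2) \<noteq> 0" "(vector [0, -1] :: real ^ 2) \<noteq> 0"
    by (auto simp: vector_2_eq_0_iff dest: sin_zero_abs_cos_one)
  have "base_triangle \<alpha> \<beta> =
      {x. vector [- sin \<alpha>, cos \<alpha>] \<bullet> x \<le> 0} \<inter>
      ({x. vector [sin \<beta>, cos \<beta>] \<bullet> x \<le> sin \<beta>} \<inter> {x. vector [0, -1] \<bullet> x \<le> 0})"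
    by (auto simp: base_triangle_def)
  then show ?thesis
    by (auto simp: interior_halfspace_le nonzero)
qed

lemma not_escapes_iff:
  assumes "path \<gamma>"
  shows "\<not> escapes \<gamma> (base_triangle \<alpha> \<beta>) s \<theta> \<longleftrightarrow>
    vector [- sin \<alpha>, cos \<alpha>] \<bullet> s < - support_fun \<gamma> (pi/2 + \<alpha> - \<theta>) \<and>
    vector [sin \<beta>, cos \<beta>] \<bullet> s < sin \<beta> - support_fun \<gamma> (pi/2 - \<beta> - \<theta>) \<and>
    vector [0, -1] \<bullet> s < - support_fun \<gamma> (- pi/2 - \<theta>)"
proof -
  \<comment> \<open>Each normal is a unit vector; naming its angle makes the support function
    applicable.\<close>
  have normals:
    "(vector [- sin \<alpha>, cos \<alpha>] :: real ^ 2) = vector [cos (pi/2 + \<alpha>), sin (pi/2 + \<alpha>)]"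
    "(vector [sin \<beta>, cos \<beta>] :: real ^ 2) = vector [cos (pi/2 - \<beta>), sin (pi/2 - \<beta>)]"
    "(vector [0, -1] :: real ^ 2) = vector [cos (- pi/2), sin (- pi/2)]"
    by (simp_all add: cos_add sin_add cos_diff sin_diff)
  have half: "(\<forall>p\<in>{0..1}. vector [cos \<phi>, sin \<phi>] \<bullet> (s + rotate_ccw \<theta> (\<gamma> p)) < b) \<longleftrightarrow>
      vector [cos \<phi>, sin \<phi>] \<bullet> s < b - support_fun \<gamma> (\<phi> - \<theta>)" for \<phi> b
  proof -
    have "vector [cos \<phi>, sin \<phi>] \<bullet> s < b - support_fun \<gamma> (\<phi> - \<theta>) \<longleftrightarrow>
        support_fun \<gamma> (\<phi> - \<theta>) < b - vector [cos \<phi>, sin \<phi>] \<bullet> s"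
      by linarith
    also have "\<dots> \<longleftrightarrow> (\<forall>p\<in>{0..1}. vector [cos \<phi>, sin \<phi>] \<bullet> (s + rotate_ccw \<theta> (\<gamma> p)) < b)"
      unfolding support_fun_less_iff[OF assms] inner_add_right inner_rotate_ccw
      by (intro ball_cong) auto
    finally show ?thesis ..
  qed
  have "\<not> escapes \<gamma> (base_triangle \<alpha> \<beta>) s \<theta> \<longleftrightarrow>
      (\<forall>p\<in>{0..1}. vector [- sin \<alpha>, cos \<alpha>] \<bullet> (s + rotate_ccw \<theta> (\<gamma> p)) < 0) \<and>
      (\<forall>p\<in>{0..1}. vector [sin \<beta>, cos \<beta>] \<bullet> (s + rotate_ccw \<theta> (\<gamma> p)) < sin \<beta>) \<and>
      (\<forall>p\<in>{0..1}. vector [0, -1] \<bullet> (s + rotate_ccw \<theta> (\<gamma> p)) < 0)"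
    unfolding escapes_def path_image_def interior_base_triangle by blast
  then show ?thesis
    unfolding normals half by simp
qed

text \<open>The three half-planes are pairwise non-parallel, so equality can be prescribed on two lines;
  equalising the three slacks to a common \<open>\<epsilon>\<close> then meets the third inequality.\<close>

lemma exists_in_three_halfplanes_iff:
  fixes \<alpha> \<beta> c\<^sub>1 c\<^sub>2 c\<^sub>3 :: real
  assumes "sin \<alpha> > 0" "sin \<beta> > 0" "sin (\<alpha> + \<beta>) > 0"
  shows "(\<exists>s::real ^ 2. vector [- sin \<alpha>, cos \<alpha>] \<bullet> s < c\<^sub>1 \<and> vector [sin \<beta>, cos \<beta>] \<bullet> s < c\<^sub>2 \<and>
      vector [0, -1] \<bullet> s < c\<^sub>3) \<longleftrightarrow>
    0 < sin \<beta> * c\<^sub>1 + sin \<alpha> * c\<^sub>2 + sin (\<alpha> + \<beta>) * c\<^sub>3"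
    (is "?L \<longleftrightarrow> 0 < ?S")
proof
  assume ?L
  then obtain s :: "real ^ 2" where s: "vector [- sin \<alpha>, cos \<alpha>] \<bullet> s < c\<^sub>1"
      "vector [sin \<beta>, cos \<beta>] \<bullet> s < c\<^sub>2" "vector [0, -1] \<bullet> s < c\<^sub>3"
    by blast
  \<comment> \<open>The linear relation between the normals, paired with \<open>s\<close>; its
    weights are positive, so the three strict inequalities add up.\<close>
  have "0 = sin \<beta> * (vector [- sin \<alpha>, cos \<alpha>] \<bullet> s) + sin \<alpha> * (vector [sin \<beta>, cos \<beta>] \<bullet> s)
      + sin (\<alpha> + \<beta>) * (vector [0, -1] \<bullet> s)"
    by (simp add: inner_vector_2 sin_add algebra_simps)
  also have "\<dots> < ?S"
    using assms s by (intro add_strict_mono mult_strict_left_mono)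
  finally show "0 < ?S" .
next
  assume pos: "0 < ?S"
  \<comment> \<open>The common slack for which the reduced bounds
    \<open>c\<^sub>j - \<epsilon>\<close> satisfy the same linear relation as the normals.\<close>
  define \<epsilon> where "\<epsilon> = ?S / (sin \<beta> + sin \<alpha> + sin (\<alpha> + \<beta>))"
  have \<epsilon>: "\<epsilon> > 0"
    unfolding \<epsilon>_def using pos assms by (intro divide_pos_pos) auto
  have "sin \<beta> + sin \<alpha> + sin (\<alpha> + \<beta>) \<noteq> 0"
    using assms by linarith
  then have "\<epsilon> * (sin \<beta> + sin \<alpha> + sin (\<alpha> + \<beta>)) = ?S"
    by (simp add: \<epsilon>_def)
  then have sum0: "sin \<beta> * (c\<^sub>1 - \<epsilon>) + sin \<alpha> * (c\<^sub>2 - \<epsilon>) + sin (\<alpha> + \<beta>) * (c\<^sub>3 - \<epsilon>) = 0"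
    by (simp add: algebra_simps)
  \<comment> \<open>The point \<open>(x, y)\<close> is the intersection of the third and first
    lines, moved inwards by \<open>\<epsilon>\<close>.\<close>
  define y where "y = - (c\<^sub>3 - \<epsilon>)"
  define x where "x = (cos \<alpha> * y - (c\<^sub>1 - \<epsilon>)) / sin \<alpha>"
  define s :: "real ^ 2" where "s = vector [x, y]"
  have x: "sin \<alpha> * x = cos \<alpha> * y - (c\<^sub>1 - \<epsilon>)"
    using assms by (simp add: x_def)
  have s1: "vector [- sin \<alpha>, cos \<alpha>] \<bullet> s = c\<^sub>1 - \<epsilon>"
    using x by (simp add: inner_vector_2 s_def)
  have s3: "vector [0, -1] \<bullet> s = c\<^sub>3 - \<epsilon>"
    by (simp add: inner_vector_2 s_def y_def)
  have "sin \<alpha> * (vector [sin \<beta>, cos \<beta>] \<bullet> s) = sin \<beta> * (sin \<alpha> * x) + sin \<alpha> * cos \<beta> * y"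
    by (simp add: inner_vector_2 s_def algebra_simps)
  also have "\<dots> = sin (\<alpha> + \<beta>) * y - sin \<beta> * (c\<^sub>1 - \<epsilon>)"
    unfolding x by (simp add: sin_add algebra_simps)
  also have "\<dots> = sin \<alpha> * (c\<^sub>2 - \<epsilon>)"
    using sum0 by (simp add: y_def algebra_simps)
  finally have s2: "vector [sin \<beta>, cos \<beta>] \<bullet> s = c\<^sub>2 - \<epsilon>"
    using assms by simp
  show ?L
    using s1 s2 s3 \<epsilon> by (intro exI[of _ s]) simp
qed

text \<open>Of the offsets \<open>b\<^sub>j\<close> only \<open>b\<^sub>2 = sin \<beta>\<close> is
  nonzero, and its weight is \<open>sin \<alpha>\<close>; this produces the threshold
  \<open>sin \<alpha> * sin \<beta>\<close>.\<close>

lemma exists_not_escapes_iff: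
  assumes "\<alpha> > 0" "\<beta> > 0" "\<alpha> + \<beta> < pi" "path \<gamma>"
  shows "(\<exists>s. \<not> escapes \<gamma> (base_triangle \<alpha> \<beta>) s \<theta>) \<longleftrightarrow>
    escape_fun \<alpha> \<beta> \<gamma> (- pi/2 - \<theta>) < sin \<alpha> * sin \<beta>"
proof -
  have sines: "sin \<alpha> > 0" "sin \<beta> > 0" "sin (\<alpha> + \<beta>) > 0"
    using assms by (auto intro!: sin_gt_zero)
  have angles: "- pi/2 - \<theta> + pi + \<alpha> = pi/2 + \<alpha> - \<theta>" "- pi/2 - \<theta> + pi - \<beta> = pi/2 - \<beta> - \<theta>"
    by simp_all
  show ?thesis
    unfolding not_escapes_iff[OF assms(4)] exists_in_three_halfplanes_iff[OF sines]
      escape_fun_def angles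
    by (simp add: algebra_simps)
qed

text \<open>The moved path starts at \<open>s\<close>. Hence letting \<open>s\<close> range over the
  whole plane instead of the triangle adds no new non-escaping positions.\<close>

lemma not_escapes_imp_mem:
  assumes "pathstart \<gamma> = 0" "\<not> escapes \<gamma> T s \<theta>"
  shows "s \<in> T"
proof -
  have "rotate_ccw \<theta> (\<gamma> 0) = 0"
    using assms(1) by (simp add: pathstart_def rotate_ccw_def vector_2_eq_0_iff)
  then have "s \<in> path_image (\<lambda>p. s + rotate_ccw \<theta> (\<gamma> p))"
    unfolding path_image_def by (auto intro!: image_eqI[of _ _ 0])
  then show ?thesis
    using assms(2) interior_subset unfolding escapes_def by blast
qed

theorem theorem4:
  fixes \<alpha> \<beta> :: real and \<gamma> :: "real \<Rightarrow> real ^ 2"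
  assumes "\<alpha> > 0" and "\<beta> > 0" and "\<alpha> + \<beta> < pi"
    and "path \<gamma>" and "pathstart \<gamma> = 0"
  shows "(\<forall>s\<in>base_triangle \<alpha> \<beta>. \<forall>\<theta>\<in>{0..<2 * pi}. escapes \<gamma> (base_triangle \<alpha> \<beta>) s \<theta>) \<longleftrightarrow>
         (\<forall>t\<in>{0..<2 * pi}. escape_fun \<alpha> \<beta> \<gamma> t \<ge> sin \<alpha> * sin \<beta>)"
proof -
  let ?F = "escape_fun \<alpha> \<beta> \<gamma>"
  have "(\<forall>s\<in>base_triangle \<alpha> \<beta>. \<forall>\<theta>\<in>{0..<2 * pi}. escapes \<gamma> (base_triangle \<alpha> \<beta>) s \<theta>) \<longleftrightarrow>
      (\<forall>\<theta>\<in>{0..<2 * pi}. \<not> (\<exists>s. \<not> escapes \<gamma> (base_triangle \<alpha> \<beta>) s \<theta>))"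
    using not_escapes_imp_mem[OF assms(5)] by blast
  also have "\<dots> \<longleftrightarrow> (\<forall>\<theta>\<in>{0..<2 * pi}. ?F (- pi/2 - \<theta>) \<ge> sin \<alpha> * sin \<beta>)"
    unfolding exists_not_escapes_iff[OF assms(1-4)] not_less ..
  also have "\<dots> \<longleftrightarrow> (\<forall>t\<in>{0..<2 * pi}. ?F t \<ge> sin \<alpha> * sin \<beta>)"
  proof (intro iffI ballI)
    fix t assume *: "\<forall>\<theta>\<in>{0..<2 * pi}. ?F (- pi/2 - \<theta>) \<ge> sin \<alpha> * sin \<beta>"
    \<comment> \<open>The map sending \<open>t\<close> to \<open>- pi/2 - t\<close> is its own
      inverse but leaves the period interval; a multiple of \<open>2 * pi\<close> brings the angle
      back without changing \<open>?F\<close>.\<close>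
    obtain k where k: "(- pi/2 - t) + 2 * pi * of_int k \<in> {0..<2 * pi}"
      by (rule shift_into_period)
    have "- pi/2 - ((- pi/2 - t) + 2 * pi * of_int k) = t + 2 * pi * of_int (- k)"
      by simp
    then show "?F t \<ge> sin \<alpha> * sin \<beta>"
      using bspec[OF * k] by (simp only: escape_fun_periodic)
  next
    fix \<theta> assume *: "\<forall>t\<in>{0..<2 * pi}. ?F t \<ge> sin \<alpha> * sin \<beta>"
    obtain k where k: "(- pi/2 - \<theta>) + 2 * pi * of_int k \<in> {0..<2 * pi}"
      by (rule shift_into_period)
    then show "?F (- pi/2 - \<theta>) \<ge> sin \<alpha> * sin \<beta>"
      using bspec[OF * k] by (simp only: escape_fun_periodic)
  qed
  finally show ?thesis .
qed

end
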